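(* Consider the problem $\min_{\mathbf{x},\mathbf{z}} f(\mathbf{x})+g(\mathbf{z})$ s.t. $A\mathbf{x}+B\mathbf{z}=\mathbf{c}$, where $f,g$ are closed, proper and convex, and assume that an optimal solution exists. Let $(\mathbf{x}^{\mathrm{opt}},\mathbf{z}^{\mathrm{opt}},\mathbf{y}^{\mathrm{opt}})$ be an optimal solution (with $\mathbf{y}^{\mathrm{opt}}$ the dual variable) and put $D_{\mathbf{z}}=\|\mathbf{z}^{\mathrm{opt}}\|_2$. Let $(\mathbf{x}_t,\mathbf{z}_t,\mathbf{y}_t)$ be generated by ADM (defined in the context) with penalty parameter $\rho>0$, started from $\mathbf{z}_0=\mathbf{0}$, $\mathbf{y}_0=\mathbf{0}$, and let $\bar{\mathbf{x}}_T=\frac1T\sum_{t=1}^T\mathbf{x}_t$, $\bar{\mathbf{z}}_T=\frac1T\sum_{t=1}^T\mathbf{z}_t$. Then for any $\mathbf{x}^*,\mathbf{z}^*$ satisfying $A\mathbf{x}^*+B\mathbf{z}^*=\mathbf{c}$ and for any $T\ge 1$, $$f(\bar{\mathbf{x}}_T)+g(\bar{\mathbf{z}}_T)-\big(f(\mathbf{x}^* )+g(\mathbf{z}^* )\big)\le \frac{\lambda_{\max}^{B}D_{\mathbf{z}}^2\,\rho}{2T},$$ where $\lambda_{\max}^{B}$ is the largest eigenvalue of $B^TB$.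
   Context: Here $A\in\mathbb{R}^{m\times n_1}$, $B\in\mathbb{R}^{m\times n_2}$, $\mathbf{c}\in\mathbb{R}^m$, $f:\mathbb{R}^{n_1}\to\mathbb{R}\cup\{+\infty\}$, $g:\mathbb{R}^{n_2}\to\mathbb{R}\cup\{+\infty\}$. ADM (alternating direction method of multipliers): for $t\ge 0$, given $(\mathbf{z}_t,\mathbf{y}_t)$, the iterates satisfy $$\mathbf{x}_{t+1}\in\operatorname{argmin}_{\mathbf{x}}\{f(\mathbf{x})+\langle\mathbf{y}_t,A\mathbf{x}+B\mathbf{z}_t-\mathbf{c}\rangle+\tfrac{\rho}{2}\|A\mathbf{x}+B\mathbf{z}_t-\mathbf{c}\|_2^2\},$$ $$\mathbf{z}_{t+1}\in\operatorname{argmin}_{\mathbf{z}}\{g(\mathbf{z})+\langle\mathbf{y}_t,A\mathbf{x}_{t+1}+B\mathbf{z}-\mathbf{c}\rangle+\tfrac{\rho}{2}\|A\mathbf{x}_{t+1}+B\mathbf{z}-\mathbf{c}\|_2^2\},$$ $$\mathbf{y}_{t+1}=\mathbf{y}_t+\rho(A\mathbf{x}_{t+1}+B\mathbf{z}_{t+1}-\mathbf{c}).$$ It is assumed that these minimizers exist. *)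

theory Defs
  imports "HOL-Analysis.Analysis"
begin

text \<open>Functions into \<open>\<real> \<union> {+\<infinity>}\<close> are rendered as \<^typ>\<open>ereal\<close>-valued functions; the value
  \<open>-\<infinity>\<close> is excluded by properness. The library's \<^const>\<open>convex_on\<close> and \<^const>\<open>epigraph\<close> only
  cover real-valued functions.\<close>

definition ereal_epigraph :: "('a \<Rightarrow> ereal) \<Rightarrow> ('a \<times> real) set" where
  "ereal_epigraph f = {(x, r). f x \<le> ereal r}"

definition proper_fun :: "('a \<Rightarrow> ereal) \<Rightarrow> bool" where
  "proper_fun f \<longleftrightarrow> (\<forall>x. f x \<noteq> - \<infinity>) \<and> (\<exists>x. f x \<noteq> \<infinity>)"

definition convex_fun :: "('a::real_vector \<Rightarrow> ereal) \<Rightarrow> bool" where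
  "convex_fun f \<longleftrightarrow> convex (ereal_epigraph f)"

definition closed_fun :: "('a::topological_space \<Rightarrow> ereal) \<Rightarrow> bool" where
  "closed_fun f \<longleftrightarrow> closed (ereal_epigraph f)"

definition lagrangian ::
  "(real^'n1 \<Rightarrow> ereal) \<Rightarrow> (real^'n2 \<Rightarrow> ereal) \<Rightarrow> real^'n1^'m \<Rightarrow> real^'n2^'m \<Rightarrow> real^'m \<Rightarrow>
    real^'n1 \<Rightarrow> real^'n2 \<Rightarrow> real^'m \<Rightarrow> ereal" where
  "lagrangian f g A B c x z y = f x + g z + ereal (y \<bullet> (A *v x + B *v z - c))"

definition dual_fun ::
  "(real^'n1 \<Rightarrow> ereal) \<Rightarrow> (real^'n2 \<Rightarrow> ereal) \<Rightarrow> real^'n1^'m \<Rightarrow> real^'n2^'m \<Rightarrow> real^'m \<Rightarrow>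
    real^'m \<Rightarrow> ereal" where
  "dual_fun f g A B c y = (INF (x, z) \<in> UNIV. lagrangian f g A B c x z y)"

text \<open>A minimizer must have a finite objective value, so a problem without a feasible point in
  \<open>dom f \<times> dom g\<close> has no optimal solution.\<close>

definition primal_optimal ::
  "(real^'n1 \<Rightarrow> ereal) \<Rightarrow> (real^'n2 \<Rightarrow> ereal) \<Rightarrow> real^'n1^'m \<Rightarrow> real^'n2^'m \<Rightarrow> real^'m \<Rightarrow>
    real^'n1 \<Rightarrow> real^'n2 \<Rightarrow> bool" where
  "primal_optimal f g A B c x z \<longleftrightarrow>
     f x + g z < \<infinity> \<and>
     is_arg_min (\<lambda>(x, z). f x + g z) (\<lambda>(x, z). A *v x + B *v z = c) (x, z)"

definition dual_optimal ::
  "(real^'n1 \<Rightarrow> ereal) \<Rightarrow> (real^'n2 \<Rightarrow> ereal) \<Rightarrow> real^'n1^'m \<Rightarrow> real^'n2^'m \<Rightarrow> real^'m \<Rightarrow>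
    real^'m \<Rightarrow> bool" where
  "dual_optimal f g A B c y \<longleftrightarrow> is_arg_max (dual_fun f g A B c) (\<lambda>_. True) y"

text \<open>Strong duality is not required. For proper \<open>f\<close> and \<open>g\<close>, every saddle point of the
  Lagrangian is an optimal solution in this sense.\<close>

definition optimal_solution ::
  "(real^'n1 \<Rightarrow> ereal) \<Rightarrow> (real^'n2 \<Rightarrow> ereal) \<Rightarrow> real^'n1^'m \<Rightarrow> real^'n2^'m \<Rightarrow> real^'m \<Rightarrow>
    real^'n1 \<Rightarrow> real^'n2 \<Rightarrow> real^'m \<Rightarrow> bool" where
  "optimal_solution f g A B c x z y \<longleftrightarrow>
     primal_optimal f g A B c x z \<and> dual_optimal f g A B c y"

text \<open>The iterate \<open>x 0\<close> plays no role: the recursion only uses \<open>z 0\<close> and \<open>y 0\<close>.\<close>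

definition adm_iterates ::
  "(real^'n1 \<Rightarrow> ereal) \<Rightarrow> (real^'n2 \<Rightarrow> ereal) \<Rightarrow> real^'n1^'m \<Rightarrow> real^'n2^'m \<Rightarrow> real^'m \<Rightarrow> real \<Rightarrow>
    (nat \<Rightarrow> real^'n1) \<Rightarrow> (nat \<Rightarrow> real^'n2) \<Rightarrow> (nat \<Rightarrow> real^'m) \<Rightarrow> bool" where
  "adm_iterates f g A B c \<rho> x z y \<longleftrightarrow>
     (\<forall>t.
        is_arg_min
          (\<lambda>u. f u + ereal (y t \<bullet> (A *v u + B *v z t - c)
                           + \<rho> / 2 * (norm (A *v u + B *v z t - c))\<^sup>2))
          (\<lambda>_. True) (x (Suc t)) \<and>
        is_arg_min
          (\<lambda>w. g w + ereal (y t \<bullet> (A *v x (Suc t) + B *v w - c)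
                           + \<rho> / 2 * (norm (A *v x (Suc t) + B *v w - c))\<^sup>2))
          (\<lambda>_. True) (z (Suc t)) \<and>
        y (Suc t) = y t + \<rho> *\<^sub>R (A *v x (Suc t) + B *v z (Suc t) - c))"

definition eigenvalues :: "real^'n^'n \<Rightarrow> real set" where
  "eigenvalues M = {l. \<exists>v. v \<noteq> 0 \<and> M *v v = l *\<^sub>R v}"

text \<open>For symmetric \<open>M\<close> the set of real eigenvalues is finite and nonempty, so \<^const>\<open>Max\<close> is
  meaningful.\<close>

definition max_eigenvalue :: "real^'n^'n \<Rightarrow> real" where
  "max_eigenvalue M = Max (eigenvalues M)"

definition average :: "nat \<Rightarrow> (nat \<Rightarrow> 'a::real_vector) \<Rightarrow> 'a" where
  "average T u = (1 / real T) *\<^sub>R (\<Sum>t = 1..T. u t)"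

end

theory Submission
  imports Defs
begin

text \<open>By optimality of \<open>(xopt, zopt)\<close> it suffices to compare with \<open>(xopt, zopt)\<close>. Adding the
  variational inequalities of the two minimizations and completing squares bounds the gap of
  step \<open>t + 1\<close> by the decrease of
  \<open>\<parallel>y t\<parallel>\<^sup>2 / (2 \<rho>) + \<rho> / 2 * \<parallel>B (z t - zopt)\<parallel>\<^sup>2\<close>. This telescopes, Jensen's inequality passes to
  the averages, and \<open>\<parallel>B zopt\<parallel>\<^sup>2\<close> is bounded by the Rayleigh quotient.\<close>

text \<open>Replaces differentiation in the first-order conditions below: perturb by
  \<open>s\<close>, divide by \<open>s\<close>, and let the remainder \<open>s * k\<close>
  vanish.\<close>

lemma le_if_le_add_small_multiple:
  fixes a b k :: real
  assumes "\<And>s. 0 < s \<Longrightarrow> s \<le> 1 \<Longrightarrow> a \<le> b + s * k"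
  shows "a \<le> b"
proof (rule tendsto_lowerbound)
  show "((\<lambda>s. b + s * k) \<longlongrightarrow> b) (at_right 0)"
    by (auto intro!: tendsto_eq_intros)
  show "\<forall>\<^sub>F s in at_right 0. a \<le> b + s * k"
    using eventually_at_right_less[of "0::real"] assms
    unfolding eventually_at_right_field by (intro exI[of _ 1]) auto
qed simp

text \<open>Eigenvectors for distinct eigenvalues are orthogonal, so choosing one for each
  eigenvalue gives a pairwise orthogonal set, which is finite in finite dimension. Finiteness makes
  \<open>Max\<close> in \<open>max_eigenvalue\<close> an upper bound.\<close>

lemma finite_eigenvalues_symmetric:
  fixes M :: "real^'n^'n"
  assumes "transpose M = M"
  shows "finite (eigenvalues M)"
proof -
  define v where "v l = (SOME v. v \<noteq> 0 \<and> M *v v = l *\<^sub>R v)" for l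
  have v: "v l \<noteq> 0" "M *v v l = l *\<^sub>R v l" if "l \<in> eigenvalues M" for l
    using someI_ex[of "\<lambda>v. v \<noteq> 0 \<and> M *v v = l *\<^sub>R v"] that
    unfolding eigenvalues_def v_def by auto
  have orth: "v k \<bullet> v l = 0" if "k \<in> eigenvalues M" "l \<in> eigenvalues M" "k \<noteq> l" for k l
  proof -
    have "(M *v v k) \<bullet> v l = v k \<bullet> (M *v v l)"
      using assms by (metis dot_lmul_matrix matrix_transpose_mul transpose_matrix_vector)
    then have "(k - l) * (v k \<bullet> v l) = 0"
      using v(2) that by (simp add: algebra_simps)
    then show ?thesis using that by simp
  qed
  \<comment> \<open>A vector chosen for two eigenvalues would be orthogonal to itself.\<close>
  have "inj_on v (eigenvalues M)"
    by (rule inj_onI) (metis orth v(1) inner_eq_zero_iff)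
  moreover have "finite (v ` eigenvalues M)"
    by (rule pairwise_orthogonal_imp_finite)
      (auto simp: pairwise_def orthogonal_def intro: orth)
  ultimately show ?thesis by (rule finite_imageD[rotated])
qed

text \<open>A maximizer of the norm of \<open>B *v v\<close> over the compact unit sphere is an
  eigenvector of \<open>transpose B ** B\<close>, and its eigenvalue is the maximum of the squared
  norm.\<close>

lemma norm_matrix_vector_le_max_eigenvalue:
  fixes B :: "real^'n^'m"
  shows "(norm (B *v w))\<^sup>2 \<le> max_eigenvalue (transpose B ** B) * (norm w)\<^sup>2"
proof -
  define M where "M = transpose B ** B"
  have M: "(M *v u) \<bullet> w = (B *v u) \<bullet> (B *v w)" for u w
    unfolding M_def
    by (simp add: dot_lmul_matrix flip: matrix_vector_mul_assoc)
  have "\<exists>v\<in>sphere 0 1. \<forall>u\<in>sphere 0 1. (norm (B *v u))\<^sup>2 \<le> (norm (B *v v))\<^sup>2"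
    by (intro continuous_attains_sup continuous_intros linear_continuous_on
          matrix_vector_mul_bounded_linear) auto
  then obtain v where v: "norm v = 1"
    and max: "\<And>u. norm u = 1 \<Longrightarrow> (norm (B *v u))\<^sup>2 \<le> (norm (B *v v))\<^sup>2"
    by auto
  define \<mu> where "\<mu> = (norm (B *v v))\<^sup>2"
  have ray: "(norm (B *v u))\<^sup>2 \<le> \<mu> * (norm u)\<^sup>2" for u
  proof (cases "u = 0")
    case False
    then have "(norm (B *v (u /\<^sub>R norm u)))\<^sup>2 \<le> \<mu>"
      unfolding \<mu>_def by (intro max) simp
    with False show ?thesis
      by (simp add: matrix_vector_mult_scaleR power_mult_distrib power_inverse field_simps)
  qed simp
  \<comment> \<open>First-order condition at \<open>v\<close>, a zero of the nonnegative form
    \<open>\<mu> * (norm u)\<^sup>2 - (norm (B *v u))\<^sup>2\<close>.\<close>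
  have crit: "(M *v v - \<mu> *\<^sub>R v) \<bullet> u \<le> 0" for u
  proof (rule le_if_le_add_small_multiple)
    fix s :: real
    assume s: "0 < s" "s \<le> 1"
    have "(norm (B *v (v + s *\<^sub>R u)))\<^sup>2 \<le> \<mu> * (norm (v + s *\<^sub>R u))\<^sup>2"
      by (rule ray)
    moreover have "(norm (B *v (v + s *\<^sub>R u)))\<^sup>2
        = \<mu> + 2 * s * ((M *v v) \<bullet> u) + s\<^sup>2 * (norm (B *v u))\<^sup>2"
      unfolding \<mu>_def M power2_norm_eq_inner
      by (simp add: matrix_vector_mult_scaleR matrix_vector_right_distrib
          inner_add_left inner_add_right inner_commute power2_eq_square)
    moreover have "(norm (v + s *\<^sub>R u))\<^sup>2 = 1 + 2 * s * (v \<bullet> u) + s\<^sup>2 * (norm u)\<^sup>2"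
      using v unfolding power2_norm_eq_inner
      by (simp add: norm_eq_1 inner_add_left inner_add_right inner_commute power2_eq_square)
    ultimately have "s * ((M *v v - \<mu> *\<^sub>R v) \<bullet> u)
        \<le> s * (s * ((\<mu> * (norm u)\<^sup>2 - (norm (B *v u))\<^sup>2) / 2))"
      by (simp add: algebra_simps power2_eq_square)
    then show "(M *v v - \<mu> *\<^sub>R v) \<bullet> u \<le> 0 + s * ((\<mu> * (norm u)\<^sup>2 - (norm (B *v u))\<^sup>2) / 2)"
      using s by simp
  qed
  \<comment> \<open>Taking the residual itself as direction in \<open>crit\<close> makes its squared
    norm nonpositive.\<close>
  have "M *v v = \<mu> *\<^sub>R v"
    using crit[of "M *v v - \<mu> *\<^sub>R v"] by (metis inner_gt_zero_iff not_le right_minus_eq)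
  then have "\<mu> \<in> eigenvalues M"
    using v unfolding eigenvalues_def by (auto intro!: exI[of _ v])
  moreover have "finite (eigenvalues M)"
    by (rule finite_eigenvalues_symmetric) (simp add: M_def matrix_transpose_mul)
  ultimately have "\<mu> \<le> max_eigenvalue M"
    unfolding max_eigenvalue_def by simp
  then have "\<mu> * (norm w)\<^sup>2 \<le> max_eigenvalue M * (norm w)\<^sup>2"
    by (simp add: mult_right_mono)
  with ray[of w] show ?thesis unfolding M_def by linarith
qed

lemma convex_funD:
  assumes "convex_fun f" "f u \<le> ereal a" "f v \<le> ereal b" "0 \<le> s" "s \<le> 1"
  shows "f ((1 - s) *\<^sub>R u + s *\<^sub>R v) \<le> ereal ((1 - s) * a + s * b)"
  using convexD_alt[of "ereal_epigraph f" "(u, a)" "(v, b)" s] assms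
  unfolding convex_fun_def ereal_epigraph_def by simp

text \<open>Jensen's inequality, read off from a convex combination of the points
  \<open>(u t, a t)\<close> of the epigraph.\<close>

lemma convex_fun_average_le:
  assumes f: "convex_fun f" and T: "T \<ge> 1"
    and le: "\<And>t. 1 \<le> t \<Longrightarrow> f (u t) \<le> ereal (a t)"
  shows "f (average T u) \<le> ereal (average T a)"
proof -
  have "(\<Sum>t = 1..T. (1 / real T) *\<^sub>R (u t, a t)) \<in> ereal_epigraph f"
    using f T le unfolding convex_fun_def
    by (intro convex_sum) (auto simp: ereal_epigraph_def)
  moreover have "(\<Sum>t = 1..T. (1 / real T) *\<^sub>R (u t, a t)) = (average T u, average T a)"
    by (simp add: prod_eq_iff fst_sum snd_sum average_def scaleR_sum_right sum_divide_distrib)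
  ultimately show ?thesis by (simp add: ereal_epigraph_def)
qed

lemma argmin_add_real_finite:
  assumes f: "proper_fun f" and min: "is_arg_min (\<lambda>u. f u + ereal (q u)) (\<lambda>_. True) p"
  shows "\<bar>f p\<bar> \<noteq> \<infinity>"
proof -
  obtain u where "f u \<noteq> \<infinity>" using f unfolding proper_fun_def by auto
  moreover have "f p + ereal (q p) \<le> f u + ereal (q u)"
    using min by (simp add: is_arg_min_linorder)
  ultimately have "f p \<noteq> \<infinity>" by auto
  with f show ?thesis unfolding proper_fun_def by auto
qed

text \<open>Compare \<open>p\<close> with points of the segment from \<open>p\<close> to
  \<open>u\<close>: convexity bounds \<open>f\<close> there, the quadratic expands exactly, and only
  its first-order term survives as \<open>s\<close> tends to 0.\<close>

lemma argmin_augmented_lagrangian: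
  fixes f :: "real^'n \<Rightarrow> ereal" and L :: "real^'n^'m" and d y :: "real^'m"
  assumes f: "convex_fun f"
    and min: "is_arg_min (\<lambda>u. f u + ereal (y \<bullet> (L *v u + d) + \<rho> / 2 * (norm (L *v u + d))\<^sup>2))
      (\<lambda>_. True) p"
    and fp: "f p = ereal a" and fu: "f u = ereal b"
  shows "a - b \<le> (y + \<rho> *\<^sub>R (L *v p + d)) \<bullet> (L *v u - L *v p)"
proof (rule le_if_le_add_small_multiple)
  fix s :: real
  assume s: "0 < s" "s \<le> 1"
  define w where "w = (1 - s) *\<^sub>R p + s *\<^sub>R u"
  define e where "e = L *v p + d"
  define h where "h = L *v u - L *v p"
  have Lw: "L *v w + d = e + s *\<^sub>R h"
    unfolding w_def e_def h_def
    by (simp add: matrix_vector_mult_scaleR matrix_vector_right_distrib algebra_simps)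
  have "f w \<le> ereal ((1 - s) * a + s * b)"
    unfolding w_def using f fp fu s by (intro convex_funD) auto
  moreover have "f p + ereal (y \<bullet> e + \<rho> / 2 * (norm e)\<^sup>2)
      \<le> f w + ereal (y \<bullet> (e + s *\<^sub>R h) + \<rho> / 2 * (norm (e + s *\<^sub>R h))\<^sup>2)"
    using min unfolding e_def Lw[unfolded e_def, symmetric] by (simp add: is_arg_min_linorder)
  \<comment> \<open>\<open>f w\<close> is finite: the first bound excludes \<infinity>, the second
    excludes -\<infinity>.\<close>
  ultimately have "a + (y \<bullet> e + \<rho> / 2 * (norm e)\<^sup>2)
      \<le> (1 - s) * a + s * b + (y \<bullet> (e + s *\<^sub>R h) + \<rho> / 2 * (norm (e + s *\<^sub>R h))\<^sup>2)"
    unfolding fp by (cases "f w") auto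
  moreover have "(norm (e + s *\<^sub>R h))\<^sup>2 = (norm e)\<^sup>2 + 2 * s * (e \<bullet> h) + s\<^sup>2 * (norm h)\<^sup>2"
    unfolding power2_norm_eq_inner
    by (simp add: inner_add_left inner_add_right inner_commute power2_eq_square)
  ultimately have "s * (a - b)
      \<le> s * (y \<bullet> h) + \<rho> / 2 * (2 * s * (e \<bullet> h) + s\<^sup>2 * (norm h)\<^sup>2)"
    by (simp add: inner_add_right algebra_simps)
  also have "\<dots> = s * ((y + \<rho> *\<^sub>R e) \<bullet> h + s * (\<rho> / 2 * (norm h)\<^sup>2))"
    by (simp add: inner_add_left algebra_simps power2_eq_square)
  finally have "s * (a - b) \<le> s * ((y + \<rho> *\<^sub>R e) \<bullet> h + s * (\<rho> / 2 * (norm h)\<^sup>2))" .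
  then show "a - b \<le> (y + \<rho> *\<^sub>R (L *v p + d)) \<bullet> (L *v u - L *v p) + s * (\<rho> / 2 * (norm h)\<^sup>2)"
    using s unfolding e_def h_def by simp
qed

text \<open>Here \<open>p = A (x (t + 1))\<close>, \<open>q = B (z (t + 1))\<close>, \<open>q' = B (z t)\<close>, and \<open>P\<close>, \<open>Q\<close> are the images
  of the comparison point.\<close>

lemma adm_step_inner_bound:
  fixes p q q' P Q c y y' :: "'a::real_inner"
  assumes "\<rho> > 0" and c: "P + Q = c" and y: "y = y' + \<rho> *\<^sub>R (p + q - c)"
  shows "(y' + \<rho> *\<^sub>R (p + q' - c)) \<bullet> (P - p) + y \<bullet> (Q - q)
    \<le> ((norm y')\<^sup>2 / (2 * \<rho>) + \<rho> / 2 * (norm (q' - Q))\<^sup>2)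
      - ((norm y)\<^sup>2 / (2 * \<rho>) + \<rho> / 2 * (norm (q - Q))\<^sup>2)"
proof -
  define r where "r = p + q - c"
  define k where "k = q' - q"
  define l where "l = q - Q"
  have subst: "P - p = l - r" "Q - q = - l" "q' - Q = k + l" "q - Q = l" "p + q' - c = r + k"
    using c unfolding r_def k_def l_def by (auto simp: algebra_simps)
  have y: "y = y' + \<rho> *\<^sub>R r" using y unfolding r_def .
  \<comment> \<open>The slack in the claim is exactly this square; \<open>k + r\<close> is the
    residual \<open>p + q' - c\<close> between the two minimizations.\<close>
  have "0 \<le> \<rho> / 2 * (norm (k + r))\<^sup>2" using assms(1) by simp
  also have "\<dots> = ((norm y')\<^sup>2 / (2 * \<rho>) + \<rho> / 2 * (norm (k + l))\<^sup>2)
      - ((norm y)\<^sup>2 / (2 * \<rho>) + \<rho> / 2 * (norm l)\<^sup>2)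
      - ((y' + \<rho> *\<^sub>R (r + k)) \<bullet> (l - r) + y \<bullet> (- l))"
    using assms(1) unfolding y power2_norm_eq_inner
    by (simp add: inner_add_left inner_add_right inner_diff_left inner_diff_right inner_commute
        field_simps power2_eq_square)
  finally show ?thesis unfolding subst by simp
qed

lemma adm_average_le:
  fixes A :: "real^'n1^'m" and B :: "real^'n2^'m" and c :: "real^'m"
  assumes f: "proper_fun f" "convex_fun f" and g: "proper_fun g" "convex_fun g"
    and "\<rho> > 0" and adm: "adm_iterates f g A B c \<rho> x z y"
    and "z 0 = 0" "y 0 = 0" and T: "T \<ge> 1"
    and feas: "A *v xs + B *v zs = c" and fxs: "f xs = ereal a" and gzs: "g zs = ereal b"
  shows "f (average T x) + g (average T z)
    \<le> ereal (a + b + (norm (B *v zs))\<^sup>2 * \<rho> / (2 * real T))"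
proof -
  \<comment> \<open>Both objectives are regrouped as \<open>L *v u + d\<close>, so one variational
    inequality serves both minimizations.\<close>
  have xmin: "is_arg_min (\<lambda>u. f u + ereal (y t \<bullet> (A *v u + (B *v z t - c))
      + \<rho> / 2 * (norm (A *v u + (B *v z t - c)))\<^sup>2)) (\<lambda>_. True) (x (Suc t))"
    and zmin: "is_arg_min (\<lambda>w. g w + ereal (y t \<bullet> (B *v w + (A *v x (Suc t) - c))
      + \<rho> / 2 * (norm (B *v w + (A *v x (Suc t) - c)))\<^sup>2)) (\<lambda>_. True) (z (Suc t))"
    and y: "y (Suc t) = y t + \<rho> *\<^sub>R (A *v x (Suc t) + B *v z (Suc t) - c)" for t
    using adm unfolding adm_iterates_def by (simp_all add: algebra_simps)
  define F where "F t = real_of_ereal (f (x t))" for t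
  define G where "G t = real_of_ereal (g (z t))" for t
  \<comment> \<open>Index 0 is excluded: only later iterates are minimizers, so
    \<open>f (x 0)\<close> and \<open>g (z 0)\<close> may be infinite.\<close>
  have F: "f (x t) = ereal (F t)" and G: "g (z t) = ereal (G t)" if "1 \<le> t" for t
    using argmin_add_real_finite[OF f(1) xmin, of "t - 1"]
      argmin_add_real_finite[OF g(1) zmin, of "t - 1"] that
    unfolding F_def G_def by (simp_all add: ereal_real)
  define V where "V t = (norm (y t))\<^sup>2 / (2 * \<rho>) + \<rho> / 2 * (norm (B *v z t - B *v zs))\<^sup>2" for t
  have step: "F (Suc t) + G (Suc t) - (a + b) \<le> V t - V (Suc t)" for t
  proof -
    have "F (Suc t) - a
        \<le> (y t + \<rho> *\<^sub>R (A *v x (Suc t) + (B *v z t - c))) \<bullet> (A *v xs - A *v x (Suc t))"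
      by (rule argmin_augmented_lagrangian[OF f(2) xmin F fxs]) simp
    moreover have "G (Suc t) - b
        \<le> (y t + \<rho> *\<^sub>R (B *v z (Suc t) + (A *v x (Suc t) - c))) \<bullet> (B *v zs - B *v z (Suc t))"
      by (rule argmin_augmented_lagrangian[OF g(2) zmin G gzs]) simp
    \<comment> \<open>The multiplier in the \<open>z\<close> inequality is already the updated one;
      the \<open>x\<close> inequality still involves the old \<open>z t\<close>.\<close>
    moreover have "y t + \<rho> *\<^sub>R (B *v z (Suc t) + (A *v x (Suc t) - c)) = y (Suc t)"
      unfolding y by (simp add: algebra_simps)
    ultimately show ?thesis
      using adm_step_inner_bound[OF \<open>\<rho> > 0\<close> feas y[of t], of "B *v z t"]
      unfolding V_def by (simp add: add_diff_eq)
  qed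
  have "(\<Sum>t = 1..n. F t + G t) \<le> real n * (a + b) + (V 0 - V n)" for n
  proof (induction n)
    case (Suc n)
    then show ?case using step[of n] by (simp add: algebra_simps)
  qed simp
  moreover have "V T \<ge> 0" "V 0 = (norm (B *v zs))\<^sup>2 * \<rho> / 2"
    using assms(5) \<open>z 0 = 0\<close> \<open>y 0 = 0\<close> unfolding V_def by simp_all
  ultimately have "(\<Sum>t = 1..T. F t + G t)
      \<le> real T * (a + b) + (norm (B *v zs))\<^sup>2 * \<rho> / 2"
    by (smt (verit))
  then have "(\<Sum>t = 1..T. F t + G t) / real T
      \<le> (real T * (a + b) + (norm (B *v zs))\<^sup>2 * \<rho> / 2) / real T"
    by (rule divide_right_mono) simp
  then have "average T F + average T G \<le> a + b + (norm (B *v zs))\<^sup>2 * \<rho> / (2 * real T)"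
    using T unfolding average_def by (simp add: sum.distrib add_divide_distrib)
  moreover have "f (average T x) + g (average T z) \<le> ereal (average T F) + ereal (average T G)"
    by (intro add_mono convex_fun_average_le f g T) (simp_all add: F G)
  ultimately show ?thesis by (auto elim: order_trans)
qed

theorem theorem1:
  fixes A :: "real^'n1^'m" and B :: "real^'n2^'m" and c :: "real^'m"
    and f :: "real^'n1 \<Rightarrow> ereal" and g :: "real^'n2 \<Rightarrow> ereal"
    and xopt :: "real^'n1" and zopt :: "real^'n2" and yopt :: "real^'m"
    and x :: "nat \<Rightarrow> real^'n1" and z :: "nat \<Rightarrow> real^'n2" and y :: "nat \<Rightarrow> real^'m"
    and xs :: "real^'n1" and zs :: "real^'n2"
    and \<rho> :: real and T :: nat
  assumes "closed_fun f" and "proper_fun f" and "convex_fun f"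
    and "closed_fun g" and "proper_fun g" and "convex_fun g"
    and "optimal_solution f g A B c xopt zopt yopt"
    and "\<rho> > 0"
    and "adm_iterates f g A B c \<rho> x z y"
    and "z 0 = 0" and "y 0 = 0"
    and "A *v xs + B *v zs = c"
    and "T \<ge> 1"
  shows "f (average T x) + g (average T z) - (f xs + g zs)
    \<le> ereal (max_eigenvalue (transpose B ** B) * (norm zopt)\<^sup>2 * \<rho> / (2 * real T))"
proof -
  have opt: "f xopt + g zopt < \<infinity>" "A *v xopt + B *v zopt = c"
      "f xopt + g zopt \<le> f xs + g zs"
    using assms(7,12) unfolding optimal_solution_def primal_optimal_def
    by (auto simp: is_arg_min_linorder)
  have notm: "f u \<noteq> -\<infinity>" "g w \<noteq> -\<infinity>" for u w
    using assms(2,5) unfolding proper_fun_def by auto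
  obtain a b where ab: "f xopt = ereal a" "g zopt = ereal b"
    using opt(1) notm(1)[of xopt] notm(2)[of zopt] by (cases "f xopt"; cases "g zopt") auto
  let ?K = "max_eigenvalue (transpose B ** B) * (norm zopt)\<^sup>2 * \<rho> / (2 * real T)"
  \<comment> \<open>Comparing with the optimum instead of \<open>(xs, zs)\<close> puts
    \<open>zopt\<close> into the bound and supplies finite values \<open>a\<close> and
    \<open>b\<close>.\<close>
  have "f (average T x) + g (average T z)
      \<le> ereal (a + b + (norm (B *v zopt))\<^sup>2 * \<rho> / (2 * real T))"
    using assms opt(2) ab by (intro adm_average_le)
  also have "(norm (B *v zopt))\<^sup>2 * \<rho> / (2 * real T) \<le> ?K"
    using assms(8) norm_matrix_vector_le_max_eigenvalue[of B zopt]
    by (intro divide_right_mono mult_right_mono) auto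
  then have "ereal (a + b + (norm (B *v zopt))\<^sup>2 * \<rho> / (2 * real T)) \<le> ereal (a + b + ?K)"
    by simp
  finally have "f (average T x) + g (average T z) \<le> ereal (a + b + ?K)" .
  moreover have "ereal (a + b) \<le> f xs + g zs"
    using opt(3) ab by simp
  \<comment> \<open>The averages have finite values by the bound just shown; if \<open>f xs\<close>
    or \<open>g zs\<close> is \<infinity>, the left side is -\<infinity>.\<close>
  ultimately show ?thesis
    using notm(1)[of xs] notm(2)[of zs] notm(1)[of "average T x"] notm(2)[of "average T z"]
    by (cases "f xs"; cases "g zs"; cases "f (average T x)"; cases "g (average T z)") auto
qed

end
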